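(* The distance $W_A(\cdot,\cdot)$ satisfies the triangle inequality: for all $\rho_1,\rho_2,\rho_3\in K$, $$W_A(\rho_1,\rho_3)\le W_A(\rho_1,\rho_2)+W_A(\rho_2,\rho_3).$$
   Context: $A(x)$, $x\in\mathbb{R}^d$, is a smooth matrix-valued function with symmetric positive definite values; $B(x)=A(x)^{-1}$ satisfies $B(x)\ge c_0I$ for some $c_0>0$ and $B(x)=(\nabla_xb(x))^\top(\nabla_xb(x))$ for a smooth injective map $b:\mathbb{R}^d\to\mathbb{R}^q$ with $b(0)=0$, $q\ge d$. $K$ is the set of measurable $\rho:\mathbb{R}^d\to[0,\infty)$ with $\int\rho\,dx=1$ and $\int|b(x)|^2\rho(x)\,dx<\infty$. The weighted Wasserstein distance $W_A(\rho,\tilde\rho)\ge0$ of $\rho,\tilde\rho\in K$ is given by $$W_A(\rho,\tilde\rho)^2=\min_{\pi}\int_{\mathbb{R}^d\times\mathbb{R}^d}|b(x)-b(y)|^2\,d\pi(x,y),$$ the minimum being over Borel probability measures $\pi$ on $\mathbb{R}^d\times\mathbb{R}^d$ with first marginal $\rho\,dx$ and second marginal $\tilde\rho\,dx$. *)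

theory Defs
  imports "HOL-Probability.Probability"
begin

text \<open>
  \<open>k\<close> times continuously differentiable on the whole space: in finite dimension a function is
  \<open>C\<^sup>k\<^sup>+\<^sup>1\<close> iff it is differentiable everywhere and all its directional derivatives
  \<open>x \<mapsto> Df(x) v\<close> are \<open>C\<^sup>k\<close>.
\<close>

primrec times_cont_differentiable ::
  "nat \<Rightarrow> ('a::euclidean_space \<Rightarrow> 'b::euclidean_space) \<Rightarrow> bool" where
  "times_cont_differentiable 0 f \<longleftrightarrow> continuous_on UNIV f"
| "times_cont_differentiable (Suc k) f \<longleftrightarrow>
     (\<forall>x. f differentiable (at x)) \<and>
     (\<forall>v. times_cont_differentiable k (\<lambda>x. frechet_derivative f (at x) v))"

definition smooth :: "('a::euclidean_space \<Rightarrow> 'b::euclidean_space) \<Rightarrow> bool" where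
  "smooth f \<longleftrightarrow> (\<forall>k. times_cont_differentiable k f)"

definition sym_pos_def :: "real ^ 'n ^ 'n \<Rightarrow> bool" where
  "sym_pos_def M \<longleftrightarrow> transpose M = M \<and> (\<forall>v. v \<noteq> 0 \<longrightarrow> v \<bullet> (M *v v) > 0)"

text \<open>The order \<open>M \<ge> N\<close> of quadratic forms.\<close>

definition loewner_ge :: "real ^ 'n ^ 'n \<Rightarrow> real ^ 'n ^ 'n \<Rightarrow> bool" where
  "loewner_ge M N \<longleftrightarrow> (\<forall>v. v \<bullet> (M *v v) \<ge> v \<bullet> (N *v v))"

text \<open>
  The set \<open>K\<close> of densities. Densities are Lebesgue measurable functions (not identified when they
  agree almost everywhere); the integrals are taken in \<open>[0,\<infinity>]\<close>, so that the conditions on them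
  include integrability.
\<close>

definition densities :: "(real ^ 'd \<Rightarrow> real ^ 'q) \<Rightarrow> (real ^ 'd \<Rightarrow> real) set" where
  "densities b = {\<rho>. \<rho> \<in> borel_measurable lebesgue \<and> (\<forall>x. 0 \<le> \<rho> x) \<and>
     (\<integral>\<^sup>+ x. ennreal (\<rho> x) \<partial>lebesgue) = 1 \<and>
     (\<integral>\<^sup>+ x. ennreal ((norm (b x))\<^sup>2 * \<rho> x) \<partial>lebesgue) < \<infinity>}"

text \<open>The Borel measure \<open>\<rho> dx\<close>.\<close>

definition density_measure :: "(real ^ 'd \<Rightarrow> real) \<Rightarrow> (real ^ 'd) measure" where
  "density_measure \<rho> = distr (density lebesgue (\<lambda>x. ennreal (\<rho> x))) borel (\<lambda>x. x)"

definition couplings ::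
  "(real ^ 'd \<Rightarrow> real) \<Rightarrow> (real ^ 'd \<Rightarrow> real) \<Rightarrow> ((real ^ 'd) \<times> (real ^ 'd)) measure set" where
  "couplings \<rho> \<rho>' = {\<pi>. sets \<pi> = sets borel \<and> prob_space \<pi> \<and>
     distr \<pi> borel fst = density_measure \<rho> \<and> distr \<pi> borel snd = density_measure \<rho>'}"

definition transport_cost ::
  "(real ^ 'd \<Rightarrow> real ^ 'q) \<Rightarrow> ((real ^ 'd) \<times> (real ^ 'd)) measure \<Rightarrow> ennreal" where
  "transport_cost b \<pi> = (\<integral>\<^sup>+ (x, y). ennreal ((norm (b x - b y))\<^sup>2) \<partial>\<pi>)"

text \<open>
  The minimal cost is written as an infimum in \<open>[0,\<infinity>]\<close>, which needs no proof that it is attained;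
  lemma \<open>weighted_wasserstein_minimum\<close> below identifies it with the minimum. For densities in \<open>K\<close>
  all costs are finite (lemma \<open>transport_cost_finite\<close>) and couplings exist (the product measure),
  so \<^const>\<open>enn2real\<close> loses nothing.
\<close>

definition weighted_wasserstein ::
  "(real ^ 'd \<Rightarrow> real ^ 'q) \<Rightarrow> (real ^ 'd \<Rightarrow> real) \<Rightarrow> (real ^ 'd \<Rightarrow> real) \<Rightarrow> real" where
  "weighted_wasserstein b \<rho> \<rho>' = sqrt (enn2real (INF \<pi>\<in>couplings \<rho> \<rho>'. transport_cost b \<pi>))"

lemma nn_integral_density_measure:
  fixes g :: "real ^ 'd \<Rightarrow> ennreal"
  assumes "\<rho> \<in> borel_measurable lebesgue" and "g \<in> borel_measurable borel"
  shows "(\<integral>\<^sup>+ x. g x \<partial>density_measure \<rho>) = (\<integral>\<^sup>+ x. ennreal (\<rho> x) * g x \<partial>lebesgue)"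
proof -
  have id: "(\<lambda>x. x) \<in> density lebesgue (\<lambda>x. ennreal (\<rho> x)) \<rightarrow>\<^sub>M (borel :: (real ^ 'd) measure)"
    by (simp add: measurable_completion)
  have g: "g \<in> borel_measurable lebesgue"
    using assms(2) by (simp add: measurable_completion)
  show ?thesis
    unfolding density_measure_def
    using assms g id by (subst nn_integral_distr) (auto intro!: nn_integral_density)
qed

lemma transport_cost_finite:
  fixes b :: "real ^ 'd \<Rightarrow> real ^ 'q"
  assumes b: "b \<in> borel_measurable borel"
    and \<rho>: "\<rho> \<in> densities b" and \<rho>': "\<rho>' \<in> densities b" and \<pi>: "\<pi> \<in> couplings \<rho> \<rho>'"
  shows "transport_cost b \<pi> < \<infinity>"
proof -
  let ?g = "\<lambda>x. ennreal (2 * (norm (b x))\<^sup>2)"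
  have g: "?g \<in> borel_measurable borel"
    using b by measurable
  have sets_\<pi>: "sets \<pi> = sets borel"
    and marg: "distr \<pi> borel fst = density_measure \<rho>" "distr \<pi> borel snd = density_measure \<rho>'"
    using \<pi> by (auto simp: couplings_def)
  have proj: "fst \<in> \<pi> \<rightarrow>\<^sub>M borel" "snd \<in> \<pi> \<rightarrow>\<^sub>M borel"
    by (simp_all add: measurable_cong_sets[OF sets_\<pi> refl] borel_measurable_continuous_onI
        continuous_on_fst continuous_on_snd)
  have finite: "(\<integral>\<^sup>+ x. ?g x \<partial>density_measure \<sigma>) < \<infinity>" if \<sigma>: "\<sigma> \<in> densities b" for \<sigma>
  proof -
    have "(\<integral>\<^sup>+ x. ?g x \<partial>density_measure \<sigma>)
        = (\<integral>\<^sup>+ x. 2 * ennreal ((norm (b x))\<^sup>2 * \<sigma> x) \<partial>lebesgue)"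
      using \<sigma> by (subst nn_integral_density_measure[OF _ g])
        (auto simp: densities_def ennreal_mult mult_ac intro!: nn_integral_cong)
    also have "\<dots> = 2 * (\<integral>\<^sup>+ x. ennreal ((norm (b x))\<^sup>2 * \<sigma> x) \<partial>lebesgue)"
    proof (rule nn_integral_cmult)
      have "b \<in> borel_measurable lebesgue"
        using b by (simp add: measurable_completion)
      moreover have "\<sigma> \<in> borel_measurable lebesgue"
        using \<sigma> by (simp add: densities_def)
      ultimately show "(\<lambda>x. ennreal ((norm (b x))\<^sup>2 * \<sigma> x)) \<in> borel_measurable lebesgue"
        by measurable
    qed
    also have "\<dots> < \<infinity>"
      using \<sigma> by (simp add: densities_def ennreal_mult_less_top)
    finally show ?thesis .
  qed
  have bound: "(norm (u - v))\<^sup>2 \<le> 2 * (norm u)\<^sup>2 + 2 * (norm v)\<^sup>2" for u v :: "real ^ 'q"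
  proof -
    have "(norm (u - v))\<^sup>2 + (norm (u + v))\<^sup>2 = 2 * (norm u)\<^sup>2 + 2 * (norm v)\<^sup>2"
      by (simp add: power2_norm_eq_inner inner_simps inner_commute)
    then show ?thesis by (smt (verit) zero_le_power2)
  qed
  have "transport_cost b \<pi> \<le> (\<integral>\<^sup>+ z. ?g (fst z) + ?g (snd z) \<partial>\<pi>)"
    unfolding transport_cost_def case_prod_beta
    by (intro nn_integral_mono) (auto simp: bound simp flip: ennreal_plus)
  also have "\<dots> = (\<integral>\<^sup>+ z. ?g (fst z) \<partial>\<pi>) + (\<integral>\<^sup>+ z. ?g (snd z) \<partial>\<pi>)"
    using measurable_compose[OF proj(1) g] measurable_compose[OF proj(2) g]
    by (rule nn_integral_add)
  also have "\<dots> = (\<integral>\<^sup>+ x. ?g x \<partial>density_measure \<rho>) + (\<integral>\<^sup>+ x. ?g x \<partial>density_measure \<rho>')"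
    unfolding marg[symmetric] using proj g by (simp add: nn_integral_distr)
  also have "\<dots> < \<infinity>"
    using finite[OF \<rho>] finite[OF \<rho>'] by simp
  finally show ?thesis .
qed

lemma weighted_wasserstein_minimum:
  assumes "b \<in> borel_measurable borel" and "\<rho> \<in> densities b" and "\<rho>' \<in> densities b"
    and \<pi>: "\<pi> \<in> couplings \<rho> \<rho>'"
    and min: "\<And>\<pi>'. \<pi>' \<in> couplings \<rho> \<rho>' \<Longrightarrow> transport_cost b \<pi> \<le> transport_cost b \<pi>'"
  shows "ennreal ((weighted_wasserstein b \<rho> \<rho>')\<^sup>2) = transport_cost b \<pi>"
proof -
  have "(INF \<pi>\<in>couplings \<rho> \<rho>'. transport_cost b \<pi>) = transport_cost b \<pi>"
    using \<pi> min by (intro antisym INF_lower INF_greatest)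
  then show ?thesis
    using transport_cost_finite[OF assms(1-4)] by (simp add: weighted_wasserstein_def)
qed

end

theory Submission
  imports Defs
begin

text \<open>
  Given nearly optimal couplings \<open>\<pi>\<close> of \<open>\<rho>1, \<rho>2\<close> and \<open>\<pi>'\<close> of \<open>\<rho>2, \<rho>3\<close>, the classical proof glues
  them along the common marginal \<open>\<rho>2\<close> into the joint law of a triple \<open>(x, y, z)\<close> and then applies
  Minkowski's inequality in \<open>L\<^sup>2\<close> to \<open>b x - b z = (b x - b y) + (b y - b z)\<close>. The usual gluing
  disintegrates both couplings with respect to \<open>y\<close>. This can be avoided, because the
  triangle inequality survives an arbitrarily small error in the middle point.

  Cut the middle space into countably many cells on which \<open>b\<close> varies by less than \<open>\<epsilon>\<close>
  (\<open>fine_discretization\<close>), and glue only along the label of the cell. For a label with countably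
  many values, conditioning is elementary: the law of a quadruple \<open>((x, y), (y', z))\<close> with the
  marginals \<open>\<pi>\<close> and \<open>\<pi>'\<close> and with \<open>y, y'\<close> in the same cell is an explicit density with respect to
  \<open>\<pi> \<Otimes> \<pi>'\<close> (\<open>gluing_along_discrete_map\<close>). Under this law
  \<open>|b x - b z| \<le> |b x - b y| + \<epsilon> + |b y' - b z|\<close>, so the law of \<open>(x, z)\<close> is a coupling of
  \<open>\<rho>1, \<rho>3\<close> whose cost is, by Minkowski's inequality, at most \<open>(R + \<epsilon> + S)\<^sup>2\<close> as soon as \<open>R\<^sup>2\<close>
  and \<open>S\<^sup>2\<close> bound the costs of \<open>\<pi>\<close> and \<open>\<pi>'\<close> (\<open>approximate_gluing\<close>). Letting \<open>\<epsilon>\<close> tend to \<open>0\<close>, and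
  \<open>R\<close> and \<open>S\<close> to the two distances, gives the triangle inequality.
\<close>

section \<open>Gluing along a map with countably many values\<close>

lemma AE_atom_nonnull:
  fixes f :: "'a \<Rightarrow> nat"
  assumes "prob_space P" and f[measurable]: "f \<in> P \<rightarrow>\<^sub>M count_space UNIV"
  shows "AE x in P. emeasure (distr P (count_space UNIV) f) {f x} \<noteq> 0"
proof -
  have "AE x in P. emeasure (distr P (count_space UNIV) f) {n} = 0 \<longrightarrow> f x \<noteq> n" for n
  proof (cases "emeasure (distr P (count_space UNIV) f) {n} = 0")
    case True
    then have "f -` {n} \<inter> space P \<in> null_sets P"
      by (auto simp: emeasure_distr null_sets_def)
    then show ?thesis
      by (rule AE_I') auto
  qed simp
  then have "AE x in P. \<forall>n. emeasure (distr P (count_space UNIV) f) {n} = 0 \<longrightarrow> f x \<noteq> n"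
    by (simp add: AE_all_countable)
  then show ?thesis by eventually_elim blast
qed

text \<open>
  Let \<open>m n\<close> be the common mass of the level \<open>n\<close> of \<open>f\<close> and \<open>g\<close>. The glued measure picks \<open>x\<close> from
  \<open>P\<close> and then \<open>y\<close> from \<open>Q\<close> conditioned on \<open>g y = f x\<close>; its density with respect to \<open>P \<Otimes> Q\<close> is
  \<open>1 / m (f x)\<close> where \<open>f x = g y\<close>, and \<open>0\<close> elsewhere. That formula is symmetric in the two
  factors, so both marginals come out in the same way.
\<close>

lemma gluing_along_discrete_map:
  fixes f :: "'a \<Rightarrow> nat" and g :: "'b \<Rightarrow> nat"
  assumes P: "prob_space P" and Q: "prob_space Q"
    and f[measurable]: "f \<in> P \<rightarrow>\<^sub>M count_space UNIV"
    and g[measurable]: "g \<in> Q \<rightarrow>\<^sub>M count_space UNIV"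
    and eq: "distr P (count_space UNIV) f = distr Q (count_space UNIV) g"
  obtains \<Gamma> where "sets \<Gamma> = sets (P \<Otimes>\<^sub>M Q)"
    and "distr \<Gamma> P fst = P" and "distr \<Gamma> Q snd = Q"
    and "AE z in \<Gamma>. f (fst z) = g (snd z)"
proof -
  interpret P: prob_space P by fact
  interpret Q: prob_space Q by fact
  interpret PQ: pair_sigma_finite P Q ..
  define m where "m n = emeasure (distr P (count_space UNIV) f) {n}" for n
  have m_fin: "m n \<noteq> \<infinity>" for n
    unfolding m_def by (simp add: emeasure_distr)
  have [measurable]: "m \<in> borel_measurable (count_space UNIV)"
    by simp
  have m_P: "m n = emeasure P {x \<in> space P. f x = n}" for n
    unfolding m_def by (simp add: emeasure_distr vimage_def Int_def conj_commute)
  have m_Q: "m n = emeasure Q {y \<in> space Q. g y = n}" for n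
    unfolding m_def eq by (simp add: emeasure_distr vimage_def Int_def conj_commute)
  have ne_P: "AE x in P. m (f x) \<noteq> 0"
    unfolding m_def using P f by (rule AE_atom_nonnull)
  have ne_Q: "AE y in Q. m (g y) \<noteq> 0"
    unfolding m_def eq using Q g by (rule AE_atom_nonnull)
  define h where "h z = (if f (fst z) = g (snd z) then inverse (m (f (fst z))) else 0)" for z
  have h[measurable]: "h \<in> borel_measurable (P \<Otimes>\<^sub>M Q)"
  proof -
    \<comment> \<open>Equality of the labels is a countable union of measurable rectangles.\<close>
    have "Measurable.pred (P \<Otimes>\<^sub>M Q) (\<lambda>z. \<exists>n. f (fst z) = n \<and> g (snd z) = n)"
      by measurable
    then have [measurable]: "Measurable.pred (P \<Otimes>\<^sub>M Q) (\<lambda>z. f (fst z) = g (snd z))"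
      by (simp add: eq_commute)
    show ?thesis
      unfolding h_def by measurable
  qed
  define \<Gamma> where "\<Gamma> = density (P \<Otimes>\<^sub>M Q) h"
  \<comment> \<open>Integrating one variable out leaves \<open>inverse (m n) * m n\<close>, which is \<open>1\<close> only off the null
    levels (on them it is \<open>\<infinity> * 0 = 0\<close>); these are almost surely not met.\<close>
  have int_Q: "AE x in P. (\<integral>\<^sup>+ y. h (x, y) \<partial>Q) = 1"
    using ne_P
  proof eventually_elim
    case (elim x)
    have "(\<integral>\<^sup>+ y. h (x, y) \<partial>Q)
        = (\<integral>\<^sup>+ y. inverse (m (f x)) * indicator {y \<in> space Q. g y = f x} y \<partial>Q)"
      by (intro nn_integral_cong) (auto simp: h_def)
    also have "\<dots> = inverse (m (f x)) * m (f x)"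
      by (subst nn_integral_cmult_indicator) (auto simp: m_Q)
    also have "\<dots> = 1"
      using elim m_fin[of "f x"] ennreal_divide_self[of "m (f x)"]
      by (simp add: divide_ennreal_def mult.commute less_top)
    finally show ?case .
  qed
  have int_P: "AE y in Q. (\<integral>\<^sup>+ x. h (x, y) \<partial>P) = 1"
    using ne_Q
  proof eventually_elim
    case (elim y)
    have "(\<integral>\<^sup>+ x. h (x, y) \<partial>P)
        = (\<integral>\<^sup>+ x. inverse (m (g y)) * indicator {x \<in> space P. f x = g y} x \<partial>P)"
      by (intro nn_integral_cong) (auto simp: h_def)
    also have "\<dots> = inverse (m (g y)) * m (g y)"
      by (subst nn_integral_cmult_indicator) (auto simp: m_P)
    also have "\<dots> = 1"
      using elim m_fin[of "g y"] ennreal_divide_self[of "m (g y)"]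
      by (simp add: divide_ennreal_def mult.commute less_top)
    finally show ?case .
  qed
  show thesis
  proof
    show "sets \<Gamma> = sets (P \<Otimes>\<^sub>M Q)" by (simp add: \<Gamma>_def)
    show "distr \<Gamma> P fst = P"
    proof (rule measure_eqI)
      fix X assume "X \<in> sets (distr \<Gamma> P fst)"
      then have X[measurable]: "X \<in> sets P" by simp
      have "emeasure (distr \<Gamma> P fst) X = (\<integral>\<^sup>+ z. h z * indicator X (fst z) \<partial>(P \<Otimes>\<^sub>M Q))"
        by (subst emeasure_distr)
          (auto simp: \<Gamma>_def emeasure_density indicator_def intro!: nn_integral_cong)
      also have "\<dots> = (\<integral>\<^sup>+ x. \<integral>\<^sup>+ y. h (x, y) * indicator X x \<partial>Q \<partial>P)"
        by (subst Q.nn_integral_fst[symmetric]) auto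
      also have "\<dots> = (\<integral>\<^sup>+ x. (\<integral>\<^sup>+ y. h (x, y) \<partial>Q) * indicator X x \<partial>P)"
        by (intro nn_integral_cong nn_integral_multc) measurable
      also have "\<dots> = (\<integral>\<^sup>+ x. indicator X x \<partial>P)"
        using int_Q by (intro nn_integral_cong_AE) (auto elim: eventually_mono)
      finally show "emeasure (distr \<Gamma> P fst) X = emeasure P X" by simp
    qed simp
    show "distr \<Gamma> Q snd = Q"
    proof (rule measure_eqI)
      fix X assume "X \<in> sets (distr \<Gamma> Q snd)"
      then have X[measurable]: "X \<in> sets Q" by simp
      have "emeasure (distr \<Gamma> Q snd) X = (\<integral>\<^sup>+ z. h z * indicator X (snd z) \<partial>(P \<Otimes>\<^sub>M Q))"
        by (subst emeasure_distr)
          (auto simp: \<Gamma>_def emeasure_density indicator_def intro!: nn_integral_cong)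
      also have "\<dots> = (\<integral>\<^sup>+ y. \<integral>\<^sup>+ x. h (x, y) * indicator X y \<partial>P \<partial>Q)"
        by (subst PQ.nn_integral_snd[symmetric]) auto
      also have "\<dots> = (\<integral>\<^sup>+ y. (\<integral>\<^sup>+ x. h (x, y) \<partial>P) * indicator X y \<partial>Q)"
        by (intro nn_integral_cong nn_integral_multc) measurable
      also have "\<dots> = (\<integral>\<^sup>+ y. indicator X y \<partial>Q)"
        using int_P by (intro nn_integral_cong_AE) (auto elim: eventually_mono)
      finally show "emeasure (distr \<Gamma> Q snd) X = emeasure Q X" by simp
    qed simp
    show "AE z in \<Gamma>. f (fst z) = g (snd z)"
      unfolding \<Gamma>_def by (subst AE_density) (auto simp: h_def)
  qed
qed

text \<open>
  The label of \<open>y\<close> is the index of the first point of a countable dense set that lies within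
  \<open>\<epsilon> / 2\<close> of \<open>b y\<close>.
\<close>

lemma fine_discretization:
  fixes b :: "'a \<Rightarrow> 'c::{metric_space, second_countable_topology}"
  assumes b[measurable]: "b \<in> borel_measurable M" and "\<epsilon> > 0"
  obtains k :: "'a \<Rightarrow> nat" where "k \<in> M \<rightarrow>\<^sub>M count_space UNIV"
    and "\<And>y y'. k y = k y' \<Longrightarrow> dist (b y) (b y') < \<epsilon>"
proof -
  obtain D :: "'c set" where D: "countable D" "\<And>X. open X \<Longrightarrow> X \<noteq> {} \<Longrightarrow> \<exists>d\<in>D. d \<in> X"
    using countable_dense_setE by metis
  define d where "d = from_nat_into D"
  define k where "k y = (LEAST n. dist (b y) (d n) < \<epsilon> / 2)" for y
  have near: "dist (b y) (d (k y)) < \<epsilon> / 2" for y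
    unfolding k_def
  proof (rule LeastI_ex)
    obtain c where "c \<in> D" "c \<in> ball (b y) (\<epsilon> / 2)"
      using D(2)[of "ball (b y) (\<epsilon> / 2)"] \<open>\<epsilon> > 0\<close> by force
    moreover obtain n where "d n = c"
      using from_nat_into_surj[OF D(1) \<open>c \<in> D\<close>] unfolding d_def by blast
    ultimately show "\<exists>n. dist (b y) (d n) < \<epsilon> / 2" by auto
  qed
  show thesis
  proof
    show "k \<in> M \<rightarrow>\<^sub>M count_space UNIV"
      unfolding k_def by measurable
    show "dist (b y) (b y') < \<epsilon>" if "k y = k y'" for y y'
      using near[of y] near[of y'] dist_triangle_half_l that by metis
  qed
qed

section \<open>Minkowski's inequality for three summands\<close>

text \<open>
  This is the Cauchy-Schwarz inequality in Engel's form. Its right-hand side is linear in the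
  squares, hence can be integrated term by term; with \<open>R, S, T\<close> the bounds on the norms this yields
  exactly the constant \<open>(R + S + T)\<^sup>2\<close> of Minkowski's inequality.
\<close>

lemma power2_add3_le_weighted:
  fixes r s t R S T :: real
  assumes "R > 0" "S > 0" "T > 0"
  shows "(r + s + t)\<^sup>2 \<le> (R + S + T) * (r\<^sup>2 / R + s\<^sup>2 / S + t\<^sup>2 / T)"
proof -
  have "(R + S + T) * (r\<^sup>2 / R + s\<^sup>2 / S + t\<^sup>2 / T) - (r + s + t)\<^sup>2
      = (S * r - R * s)\<^sup>2 / (R * S) + (T * r - R * t)\<^sup>2 / (R * T) + (T * s - S * t)\<^sup>2 / (S * T)"
    using assms by (simp add: field_simps power2_eq_square)
  also have "\<dots> \<ge> 0"
    using assms by simp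
  finally show ?thesis by simp
qed

lemma nn_integral_power2_add3_le:
  fixes r s t :: "'a \<Rightarrow> real"
  assumes [measurable]: "r \<in> borel_measurable M" "s \<in> borel_measurable M" "t \<in> borel_measurable M"
    and pos: "R > 0" "S > 0" "T > 0"
    and r: "(\<integral>\<^sup>+ x. ennreal ((r x)\<^sup>2) \<partial>M) \<le> ennreal (R\<^sup>2)"
    and s: "(\<integral>\<^sup>+ x. ennreal ((s x)\<^sup>2) \<partial>M) \<le> ennreal (S\<^sup>2)"
    and t: "(\<integral>\<^sup>+ x. ennreal ((t x)\<^sup>2) \<partial>M) \<le> ennreal (T\<^sup>2)"
  shows "(\<integral>\<^sup>+ x. ennreal ((r x + s x + t x)\<^sup>2) \<partial>M) \<le> ennreal ((R + S + T)\<^sup>2)"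
proof -
  let ?c = "R + S + T"
  have scale: "ennreal (?c / U) * I \<le> ennreal (?c * U)"
    if "I \<le> ennreal (U\<^sup>2)" "U > 0" for I U
  proof -
    have "ennreal (?c / U) * I \<le> ennreal (?c / U) * ennreal (U\<^sup>2)"
      using that(1) by (rule mult_left_mono) simp
    also have "\<dots> = ennreal (?c * U)"
      using that(2) pos by (subst ennreal_mult[symmetric]) (auto simp: power2_eq_square)
    finally show ?thesis .
  qed
  have "(\<integral>\<^sup>+ x. ennreal ((r x + s x + t x)\<^sup>2) \<partial>M)
      \<le> (\<integral>\<^sup>+ x. ennreal (?c / R) * ennreal ((r x)\<^sup>2) + ennreal (?c / S) * ennreal ((s x)\<^sup>2)
          + ennreal (?c / T) * ennreal ((t x)\<^sup>2) \<partial>M)"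
  proof (rule nn_integral_mono)
    fix x
    have "(r x + s x + t x)\<^sup>2
        \<le> ?c / R * (r x)\<^sup>2 + ?c / S * (s x)\<^sup>2 + ?c / T * (t x)\<^sup>2"
      using power2_add3_le_weighted[OF pos, of "r x" "s x" "t x"] by (simp add: distrib_left)
    then show "ennreal ((r x + s x + t x)\<^sup>2)
        \<le> ennreal (?c / R) * ennreal ((r x)\<^sup>2) + ennreal (?c / S) * ennreal ((s x)\<^sup>2)
          + ennreal (?c / T) * ennreal ((t x)\<^sup>2)"
      using pos by (simp add: ennreal_leI flip: ennreal_mult ennreal_plus)
  qed
  also have "\<dots> = ennreal (?c / R) * (\<integral>\<^sup>+ x. ennreal ((r x)\<^sup>2) \<partial>M)
      + ennreal (?c / S) * (\<integral>\<^sup>+ x. ennreal ((s x)\<^sup>2) \<partial>M)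
      + ennreal (?c / T) * (\<integral>\<^sup>+ x. ennreal ((t x)\<^sup>2) \<partial>M)"
    by (simp add: nn_integral_add nn_integral_cmult)
  also have "\<dots> \<le> ennreal (?c * R) + ennreal (?c * S) + ennreal (?c * T)"
    using scale[OF r] scale[OF s] scale[OF t] pos by (intro add_mono) auto
  also have "\<dots> = ennreal (?c\<^sup>2)"
    using pos by (simp add: power2_eq_square distrib_left flip: ennreal_plus)
  finally show ?thesis .
qed

section \<open>Couplings\<close>

lemma prob_space_density_measure:
  assumes "\<rho> \<in> densities b"
  shows "prob_space (density_measure \<rho>)"
proof -
  have "emeasure (density lebesgue (\<lambda>x. ennreal (\<rho> x))) UNIV = 1"
    using assms by (subst emeasure_density) (auto simp: densities_def)
  then have "prob_space (density lebesgue (\<lambda>x. ennreal (\<rho> x)))"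
    by (intro prob_spaceI) simp
  moreover have "(\<lambda>x. x) \<in> density lebesgue (\<lambda>x. ennreal (\<rho> x)) \<rightarrow>\<^sub>M borel"
    by (simp add: measurable_completion)
  ultimately show ?thesis
    unfolding density_measure_def by (rule prob_space.prob_space_distr)
qed

lemma product_coupling:
  fixes \<rho> \<rho>' :: "real ^ 'd \<Rightarrow> real"
  assumes "\<rho> \<in> densities b" "\<rho>' \<in> densities b"
  shows "density_measure \<rho> \<Otimes>\<^sub>M density_measure \<rho>' \<in> couplings \<rho> \<rho>'"
proof -
  interpret P: prob_space "density_measure \<rho>" using assms(1) by (rule prob_space_density_measure)
  interpret Q: prob_space "density_measure \<rho>'" using assms(2) by (rule prob_space_density_measure)
  interpret PQ: pair_prob_space "density_measure \<rho>" "density_measure \<rho>'" ..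
  have S: "sets (density_measure \<rho>) = sets borel" "sets (density_measure \<rho>') = sets borel"
    by (simp_all add: density_measure_def)
  have "sets (density_measure \<rho> \<Otimes>\<^sub>M density_measure \<rho>') = sets borel"
    using S by (simp add: borel_prod[symmetric] cong: sets_pair_measure_cong)
  moreover have "distr (density_measure \<rho> \<Otimes>\<^sub>M density_measure \<rho>') borel fst = density_measure \<rho>"
    using Q.distr_pair_fst[of "density_measure \<rho>"] S by (simp cong: distr_cong)
  moreover have "distr (density_measure \<rho> \<Otimes>\<^sub>M density_measure \<rho>') borel snd = density_measure \<rho>'"
  proof (rule measure_eqI)
    fix X assume "X \<in> sets (distr (density_measure \<rho> \<Otimes>\<^sub>M density_measure \<rho>') borel snd)"
    then have "X \<in> sets (density_measure \<rho>')" by (simp add: S)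
    moreover from this have "snd -` X \<inter> space (density_measure \<rho> \<Otimes>\<^sub>M density_measure \<rho>')
        = space (density_measure \<rho>) \<times> X"
      using sets.sets_into_space by (fastforce simp: space_pair_measure)
    moreover have "snd \<in> density_measure \<rho> \<Otimes>\<^sub>M density_measure \<rho>' \<rightarrow>\<^sub>M (borel :: (real ^ 'd) measure)"
      using measurable_snd[of "density_measure \<rho>" "density_measure \<rho>'"]
      by (simp add: measurable_cong_sets[OF refl S(2)])
    ultimately show "emeasure (distr (density_measure \<rho> \<Otimes>\<^sub>M density_measure \<rho>') borel snd) X
        = emeasure (density_measure \<rho>') X"
      using Q.emeasure_pair_measure_Times[OF sets.top, of X "density_measure \<rho>"]
      by (simp add: emeasure_distr S P.emeasure_space_1)
  qed (simp add: S)
  ultimately show ?thesis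
    by (simp add: couplings_def PQ.prob_space_axioms)
qed

text \<open>
  The two middle points of the glued measure agree only up to the cell, and the cost of this is \<open>\<epsilon>\<close>
  in the \<open>L\<^sup>2\<close> norm.
\<close>

lemma approximate_gluing:
  fixes b :: "real ^ 'd \<Rightarrow> real ^ 'q"
  assumes b[measurable]: "b \<in> borel_measurable borel"
    and P: "\<pi> \<in> couplings \<rho>1 \<rho>2" and Q: "\<pi>' \<in> couplings \<rho>2 \<rho>3"
    and pos: "R > 0" "S > 0" "\<epsilon> > 0"
    and cost_P: "transport_cost b \<pi> \<le> ennreal (R\<^sup>2)"
    and cost_Q: "transport_cost b \<pi>' \<le> ennreal (S\<^sup>2)"
  obtains \<gamma> where "\<gamma> \<in> couplings \<rho>1 \<rho>3"
    and "transport_cost b \<gamma> \<le> ennreal ((R + \<epsilon> + S)\<^sup>2)"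
proof -
  have sets_P[measurable_cong]: "sets \<pi> = sets (borel \<Otimes>\<^sub>M borel)" and "prob_space \<pi>"
    and marg_P: "distr \<pi> borel fst = density_measure \<rho>1" "distr \<pi> borel snd = density_measure \<rho>2"
    using P unfolding couplings_def borel_prod by blast+
  have sets_Q[measurable_cong]: "sets \<pi>' = sets (borel \<Otimes>\<^sub>M borel)" and "prob_space \<pi>'"
    and marg_Q: "distr \<pi>' borel fst = density_measure \<rho>2" "distr \<pi>' borel snd = density_measure \<rho>3"
    using Q unfolding couplings_def borel_prod by blast+
  obtain k :: "real ^ 'd \<Rightarrow> nat" where k[measurable]: "k \<in> borel \<rightarrow>\<^sub>M count_space UNIV"
    and fine: "\<And>y y'. k y = k y' \<Longrightarrow> dist (b y) (b y') < \<epsilon>"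
    using fine_discretization[OF b \<open>\<epsilon> > 0\<close>] by blast
  have "distr \<pi> (count_space UNIV) (\<lambda>p. k (snd p)) = distr (distr \<pi> borel snd) (count_space UNIV) k"
    by (subst distr_distr) (auto simp: comp_def)
  also have "\<dots> = distr \<pi>' (count_space UNIV) (\<lambda>p. k (fst p))"
    unfolding marg_P marg_Q[symmetric] by (subst distr_distr) (auto simp: comp_def)
  finally obtain \<Gamma> where sets_\<Gamma>[measurable_cong]: "sets \<Gamma> = sets (\<pi> \<Otimes>\<^sub>M \<pi>')"
    and \<Gamma>: "distr \<Gamma> \<pi> fst = \<pi>" "distr \<Gamma> \<pi>' snd = \<pi>'"
    and AE: "AE z in \<Gamma>. k (snd (fst z)) = k (fst (snd z))"
    using \<open>prob_space \<pi>\<close> \<open>prob_space \<pi>'\<close>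
    by (elim gluing_along_discrete_map[rotated 4]) measurable
  interpret \<Gamma>: prob_space \<Gamma>
    using \<open>prob_space \<pi>\<close> by (intro prob_space_distrD[of fst \<Gamma> \<pi>]) (simp_all add: \<Gamma>)
  define \<gamma> where "\<gamma> = distr \<Gamma> (borel \<Otimes>\<^sub>M borel) (\<lambda>z. (fst (fst z), snd (snd z)))"
  have ends[measurable]: "(\<lambda>z. (fst (fst z), snd (snd z))) \<in> \<Gamma> \<rightarrow>\<^sub>M borel \<Otimes>\<^sub>M borel"
    by measurable
  show thesis
  proof
    have "distr \<gamma> borel fst = distr (distr \<Gamma> \<pi> fst) borel fst"
      unfolding \<gamma>_def by (subst (1 2) distr_distr) (auto simp: comp_def)
    moreover have "distr \<gamma> borel snd = distr (distr \<Gamma> \<pi>' snd) borel snd"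
      unfolding \<gamma>_def by (subst (1 2) distr_distr) (auto simp: comp_def)
    moreover have "prob_space \<gamma>"
      unfolding \<gamma>_def by (rule \<Gamma>.prob_space_distr) measurable
    ultimately show "\<gamma> \<in> couplings \<rho>1 \<rho>3"
      by (simp add: couplings_def \<Gamma> marg_P marg_Q) (simp add: \<gamma>_def borel_prod)
    define r where "r z = norm (b (fst (fst z)) - b (snd (fst z)))"
      for z :: "((real ^ 'd) \<times> (real ^ 'd)) \<times> (real ^ 'd) \<times> (real ^ 'd)"
    define s where "s z = norm (b (fst (snd z)) - b (snd (snd z)))"
      for z :: "((real ^ 'd) \<times> (real ^ 'd)) \<times> (real ^ 'd) \<times> (real ^ 'd)"
    have [measurable]: "r \<in> borel_measurable \<Gamma>" "s \<in> borel_measurable \<Gamma>"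
      unfolding r_def s_def by measurable
    have int_r: "(\<integral>\<^sup>+ z. ennreal ((r z)\<^sup>2) \<partial>\<Gamma>) \<le> ennreal (R\<^sup>2)"
      using cost_P unfolding transport_cost_def case_prod_beta r_def
      by (subst (asm) \<Gamma>(1)[symmetric], subst (asm) nn_integral_distr) simp_all
    have int_s: "(\<integral>\<^sup>+ z. ennreal ((s z)\<^sup>2) \<partial>\<Gamma>) \<le> ennreal (S\<^sup>2)"
      using cost_Q unfolding transport_cost_def case_prod_beta s_def
      by (subst (asm) \<Gamma>(2)[symmetric], subst (asm) nn_integral_distr) simp_all
    have "transport_cost b \<gamma>
        = (\<integral>\<^sup>+ z. ennreal ((norm (b (fst (fst z)) - b (snd (snd z))))\<^sup>2) \<partial>\<Gamma>)"
      unfolding transport_cost_def case_prod_beta \<gamma>_def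
      by (subst nn_integral_distr[OF ends]) simp_all
    also have "\<dots> \<le> (\<integral>\<^sup>+ z. ennreal ((r z + \<epsilon> + s z)\<^sup>2) \<partial>\<Gamma>)"
    proof (rule nn_integral_mono_AE)
      show "AE z in \<Gamma>. ennreal ((norm (b (fst (fst z)) - b (snd (snd z))))\<^sup>2)
          \<le> ennreal ((r z + \<epsilon> + s z)\<^sup>2)"
        using AE
      proof eventually_elim
        case (elim z)
        have "norm (b (fst (fst z)) - b (snd (snd z))) \<le> r z + \<epsilon> + s z"
          using fine[OF elim] unfolding r_def s_def dist_norm[symmetric]
          by (smt (verit) dist_triangle)
        then show ?case by (intro ennreal_leI power_mono) auto
      qed
    qed
    also have "\<dots> \<le> ennreal ((R + \<epsilon> + S)\<^sup>2)"
      using int_r int_s pos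
      by (intro nn_integral_power2_add3_le) (auto simp: \<Gamma>.emeasure_space_1)
    finally show "transport_cost b \<gamma> \<le> ennreal ((R + \<epsilon> + S)\<^sup>2)" .
  qed
qed

section \<open>The triangle inequality\<close>

lemma weighted_wasserstein_le:
  assumes "\<pi> \<in> couplings \<rho> \<rho>'" and "transport_cost b \<pi> \<le> ennreal (R\<^sup>2)" and "0 \<le> R"
  shows "weighted_wasserstein b \<rho> \<rho>' \<le> R"
proof -
  have "(INF \<pi>\<in>couplings \<rho> \<rho>'. transport_cost b \<pi>) \<le> ennreal (R\<^sup>2)"
    using assms(1,2) by (rule INF_lower2)
  then have "enn2real (INF \<pi>\<in>couplings \<rho> \<rho>'. transport_cost b \<pi>) \<le> R\<^sup>2"
    using enn2real_leI by auto
  then show ?thesis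
    unfolding weighted_wasserstein_def using assms(3) by (intro real_le_lsqrt)
qed

text \<open>
  The conversion to a real number sends \<open>\<infinity>\<close> to \<open>0\<close>, so it must be known that the infimum is finite.
  The product coupling shows this.
\<close>

lemma weighted_wasserstein_less:
  fixes b :: "real ^ 'd \<Rightarrow> real ^ 'q"
  assumes b: "b \<in> borel_measurable borel" and \<rho>: "\<rho> \<in> densities b" "\<rho>' \<in> densities b"
    and less: "weighted_wasserstein b \<rho> \<rho>' < R"
  obtains \<pi> where "\<pi> \<in> couplings \<rho> \<rho>'" and "transport_cost b \<pi> \<le> ennreal (R\<^sup>2)"
proof -
  let ?I = "INF \<pi>\<in>couplings \<rho> \<rho>'. transport_cost b \<pi>"
  have "?I \<le> transport_cost b (density_measure \<rho> \<Otimes>\<^sub>M density_measure \<rho>')"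
    using product_coupling[OF \<rho>] by (rule INF_lower)
  also have "\<dots> < \<infinity>"
    using transport_cost_finite[OF b \<rho> product_coupling[OF \<rho>]] .
  finally have fin: "?I < top" by simp
  have "enn2real ?I < R\<^sup>2"
    using power_strict_mono[OF less, of 2] by (simp add: weighted_wasserstein_def)
  then have "?I < ennreal (R\<^sup>2)"
    using fin ennreal_less_iff[of "enn2real ?I" "R\<^sup>2"] by simp
  then show thesis
    using that by (auto simp: INF_less_iff intro: less_imp_le)
qed

theorem lemma3p4:
  fixes A B :: "real ^ 'd \<Rightarrow> real ^ 'd ^ 'd"
    and b :: "real ^ 'd \<Rightarrow> real ^ 'q"
    and c0 :: real
    and \<rho>1 \<rho>2 \<rho>3 :: "real ^ 'd \<Rightarrow> real"
  assumes "CARD('d) \<le> CARD('q)"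
    and "smooth A"
    and "\<forall>x. sym_pos_def (A x)"
    and "\<forall>x. B x = matrix_inv (A x)"
    and "c0 > 0"
    and "\<forall>x. loewner_ge (B x) (c0 *\<^sub>R mat 1)"
    and "smooth b"
    and "inj b"
    and "b 0 = 0"
    and "\<forall>x. B x = transpose (jacobian b (at x)) ** jacobian b (at x)"
    and "\<rho>1 \<in> densities b"
    and "\<rho>2 \<in> densities b"
    and "\<rho>3 \<in> densities b"
  shows "weighted_wasserstein b \<rho>1 \<rho>3
      \<le> weighted_wasserstein b \<rho>1 \<rho>2 + weighted_wasserstein b \<rho>2 \<rho>3"
proof (rule field_le_epsilon)
  fix e :: real assume "0 < e"
  have "continuous_on UNIV b"
    using \<open>smooth b\<close> times_cont_differentiable.simps(1) unfolding smooth_def by blast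
  then have b: "b \<in> borel_measurable borel"
    by (rule borel_measurable_continuous_onI)
  define R where "R = weighted_wasserstein b \<rho>1 \<rho>2 + e / 3"
  define S where "S = weighted_wasserstein b \<rho>2 \<rho>3 + e / 3"
  have less: "weighted_wasserstein b \<rho>1 \<rho>2 < R" "weighted_wasserstein b \<rho>2 \<rho>3 < S"
    using \<open>0 < e\<close> by (simp_all add: R_def S_def)
  have pos: "0 < R" "0 < S"
    using \<open>0 < e\<close> by (simp_all add: R_def S_def weighted_wasserstein_def add_nonneg_pos)
  obtain \<pi> where \<pi>: "\<pi> \<in> couplings \<rho>1 \<rho>2" "transport_cost b \<pi> \<le> ennreal (R\<^sup>2)"
    using weighted_wasserstein_less[OF b \<open>\<rho>1 \<in> densities b\<close> \<open>\<rho>2 \<in> densities b\<close> less(1)] .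
  obtain \<pi>' where \<pi>': "\<pi>' \<in> couplings \<rho>2 \<rho>3" "transport_cost b \<pi>' \<le> ennreal (S\<^sup>2)"
    using weighted_wasserstein_less[OF b \<open>\<rho>2 \<in> densities b\<close> \<open>\<rho>3 \<in> densities b\<close> less(2)] .
  obtain \<gamma> where "\<gamma> \<in> couplings \<rho>1 \<rho>3" "transport_cost b \<gamma> \<le> ennreal ((R + e / 3 + S)\<^sup>2)"
    using approximate_gluing[OF b \<pi>(1) \<pi>'(1) pos _ \<pi>(2) \<pi>'(2), of "e / 3"] \<open>0 < e\<close> by auto
  then have "weighted_wasserstein b \<rho>1 \<rho>3 \<le> R + e / 3 + S"
    using pos \<open>0 < e\<close> by (intro weighted_wasserstein_le) auto
  then show "weighted_wasserstein b \<rho>1 \<rho>3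
      \<le> weighted_wasserstein b \<rho>1 \<rho>2 + weighted_wasserstein b \<rho>2 \<rho>3 + e"
    by (simp add: R_def S_def)
qed

end
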